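(* Let $f : \mathbb{C}[u_1,\dots,u_m] \to \mathbb{C}$ be a Frobenius $n$-homomorphism. Then there are points $\mathbf{x}_1,\dots,\mathbf{x}_n \in \mathbb{C}^m$ such that $f(p) = p(\mathbf{x}_1) + p(\mathbf{x}_2) + \dots + p(\mathbf{x}_n)$ for every polynomial $p \in \mathbb{C}[u_1,\dots,u_m]$.
   Context: For a commutative unital $\mathbb{C}$-algebra $A$, a $\mathbb{C}$-linear map $f : A \to \mathbb{C}$ and $k \ge 1$, define $\Phi_k(f) : A^k \to \mathbb{C}$ by $\Phi_k(f)(a_1,\dots,a_k) = \sum_{\sigma \in \Sigma_k} \epsilon(\sigma) f_\sigma(a_1,\dots,a_k)$, where $\epsilon(\sigma)$ is the sign of $\sigma$, and if $\sigma = \gamma_1\cdots\gamma_q$ is the decomposition into disjoint cycles (including cycles of length one) then $f_\sigma = f_{\gamma_1}\cdots f_{\gamma_q}$, where for a cycle $\gamma = (r_1\,\dots\,r_j)$, $f_\gamma(a_1,\dots,a_k) = f(a_{r_1}\cdots a_{r_j})$. A $\mathbb{C}$-linear map $f$ is a Frobenius $n$-homomorphism if $\Phi_{n+1}(f)$ vanishes identically and $f(1) = n$. *)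

theory Defs
  imports
    "HOL-Analysis.Finite_Cartesian_Product"
    "HOL-Combinatorics.Orbits"
    "HOL-Library.Poly_Mapping"
begin

section \<open>Frobenius n-homomorphisms\<close>

text \<open>
  A commutative unital complex algebra is a type of class \<open>comm_ring_1\<close> together with an explicit
  scalar multiplication by complex numbers.
\<close>

locale comm_complex_algebra = vector_space smul
  for smul :: "complex \<Rightarrow> 'a::comm_ring_1 \<Rightarrow> 'a" +
  assumes smul_mult_left: "smul c (a * b) = smul c a * b"

text \<open>
  A \<open>k\<close>-tuple is a function on \<open>nat\<close> of which only the values on \<open>{1..k}\<close> matter.  The supports
  of the disjoint cycles of a permutation \<open>\<sigma>\<close> of \<open>{1..k}\<close> are the orbits of \<open>\<sigma>\<close> on \<open>{1..k}\<close>, where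
  a fixed point \<open>r\<close> contributes \<open>orbit \<sigma> r = {r}\<close>.  As the algebra is commutative,
  \<open>f (a r\<^sub>1 * \<dots> * a r\<^sub>j)\<close> depends on the cycle \<open>(r\<^sub>1 \<dots> r\<^sub>j)\<close> only through its support.
\<close>

definition cycle_eval :: "('a::comm_ring_1 \<Rightarrow> complex) \<Rightarrow> (nat \<Rightarrow> 'a) \<Rightarrow> nat set \<Rightarrow> complex" where
  "cycle_eval f a C = f (\<Prod>r\<in>C. a r)"

definition perm_eval ::
  "('a::comm_ring_1 \<Rightarrow> complex) \<Rightarrow> nat \<Rightarrow> (nat \<Rightarrow> nat) \<Rightarrow> (nat \<Rightarrow> 'a) \<Rightarrow> complex" where
  "perm_eval f k \<sigma> a = (\<Prod>C \<in> orbit \<sigma> ` {1..k}. cycle_eval f a C)"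

definition Phi :: "nat \<Rightarrow> ('a::comm_ring_1 \<Rightarrow> complex) \<Rightarrow> (nat \<Rightarrow> 'a) \<Rightarrow> complex" where
  "Phi k f a = (\<Sum>\<sigma> | \<sigma> permutes {1..k}. of_int (sign \<sigma>) * perm_eval f k \<sigma> a)"

definition frobenius_hom ::
  "(complex \<Rightarrow> 'a::comm_ring_1 \<Rightarrow> 'a) \<Rightarrow> nat \<Rightarrow> ('a \<Rightarrow> complex) \<Rightarrow> bool" where
  "frobenius_hom smul n f \<longleftrightarrow>
     Vector_Spaces.linear smul (*) f \<and> (\<forall>a. Phi (n + 1) f a = 0) \<and> f 1 = of_nat n"


section \<open>Complex polynomials in finitely many variables\<close>

text \<open>
  For a finite type \<open>'m\<close> with \<open>m\<close> elements, \<open>'m cpoly\<close> is the polynomial ring in \<open>m\<close> variables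
  indexed by \<open>'m\<close>: a polynomial is the finitely supported map from exponent vectors to
  coefficients, multiplied by convolution.
\<close>

type_synonym 'm cpoly = "('m \<Rightarrow>\<^sub>0 nat) \<Rightarrow>\<^sub>0 complex"

definition cpoly_smul :: "complex \<Rightarrow> 'm cpoly \<Rightarrow> 'm cpoly" where
  "cpoly_smul c p = Poly_Mapping.single 0 c * p"

lemma comm_complex_algebra_cpoly: "comm_complex_algebra cpoly_smul"
  by unfold_locales
    (simp_all add: cpoly_smul_def distrib_left distrib_right single_add mult_single flip: mult.assoc)

definition cpoly_eval :: "'m::finite cpoly \<Rightarrow> complex ^ 'm \<Rightarrow> complex" where
  "cpoly_eval p x =
     (\<Sum>e \<in> Poly_Mapping.keys p.
        Poly_Mapping.lookup p e * (\<Prod>i\<in>UNIV. (x $ i) ^ Poly_Mapping.lookup e i))"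

end

theory Submission
  imports Defs "HOL-Computational_Algebra.Fundamental_Theorem_Algebra"
begin

text \<open>
  The radical \<open>{a. \<forall>b. f (a * b) = 0}\<close> is an ideal.  Splitting off one argument expresses
  \<open>\<Phi>\<^sub>k\<^sub>+\<^sub>1\<close> through \<open>\<Phi>\<^sub>k\<close>, which evaluates \<open>\<Phi>\<^sub>n\<^sub>+\<^sub>1(b, a, \<dots>, a)\<close> and gives three facts: every
  element satisfies a nonzero polynomial equation modulo the radical, the quotient by the radical is
  reduced, and \<open>f e \<in> {0, \<dots>, n}\<close> for each idempotent \<open>e\<close> of the quotient.  Hence each variable is
  annihilated modulo the radical by a polynomial with simple roots, so the quotient is spanned by
  orthogonal idempotents \<open>e\<^sub>g\<close> on which every polynomial \<open>p\<close> acts as \<open>p(g)\<close>, for finitely many points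
  \<open>g\<close>.  Then \<open>f p\<close> is the sum of the \<open>p(g)\<close> with the multiplicities \<open>f e\<^sub>g\<close>, which add up to
  \<open>f 1 = n\<close>.
\<close>

section \<open>A recursion for the alternating permutation sums\<close>

text \<open>
  Arbitrary index sets \<open>S\<close> allow any argument of \<open>\<Phi>\<close> to be split off without proving its symmetry.
\<close>

definition perm_sum :: "nat set \<Rightarrow> ('a::comm_ring_1 \<Rightarrow> complex) \<Rightarrow> (nat \<Rightarrow> 'a) \<Rightarrow> complex" where
  "perm_sum S f a = (\<Sum>\<sigma> | \<sigma> permutes S.
     of_int (sign \<sigma>) * (\<Prod>C \<in> orbit \<sigma> ` S. cycle_eval f a C))"

lemma Phi_eq_perm_sum: "Phi k f a = perm_sum {1..k} f a"
  by (simp add: Phi_def perm_eval_def perm_sum_def)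

lemma perm_sum_cong:
  assumes "\<And>i. i \<in> S \<Longrightarrow> a i = b i"
  shows "perm_sum S f a = perm_sum S f b"
proof -
  have "cycle_eval f a C = cycle_eval f b C" if "\<sigma> permutes S" "C \<in> orbit \<sigma> ` S" for \<sigma> C
  proof -
    have "C \<subseteq> S"
      using that permutes_orbit_subset by fastforce
    then show ?thesis
      using assms unfolding cycle_eval_def by (intro arg_cong[of _ _ f] prod.cong) auto
  qed
  then show ?thesis
    unfolding perm_sum_def by (auto intro!: sum.cong prod.cong)
qed

lemma perm_sum_empty [simp]: "perm_sum {} f a = 1"
  by (simp add: perm_sum_def sign_id)

text \<open>
  Composing \<open>\<tau>\<close> with the transposition of \<open>x\<close> and \<open>j\<close> inserts \<open>x\<close> in front of \<open>j\<close> in its cycle.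
\<close>

lemma orbit_transpose_comp:
  assumes \<tau>: "\<tau> permutes S" and x: "x \<notin> S" and j: "j \<in> S" and i: "i \<in> S"
  shows "orbit (transpose x j \<circ> \<tau>) i
    = (if j \<in> orbit \<tau> i then insert x (orbit \<tau> i) else orbit \<tau> i)"
proof -
  define \<sigma> where "\<sigma> = transpose x j \<circ> \<tau>"
  have \<tau>x: "\<tau> x = x" and \<tau>S: "\<And>z. z \<in> S \<Longrightarrow> \<tau> z \<in> S"
    using \<tau> x by (auto simp: permutes_not_in permutes_in_image)
  have \<sigma>x: "\<sigma> x = j"
    using \<tau>x by (simp add: \<sigma>_def)
  have \<sigma>j: "\<sigma> z = x" if "\<tau> z = j" for z
    using that by (simp add: \<sigma>_def)
  have \<sigma>other: "\<sigma> z = \<tau> z" if "\<tau> z \<noteq> j" "z \<in> S" for z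
    using that \<tau>S[of z] x by (auto simp: \<sigma>_def transpose_def)
  \<comment> \<open>A step of \<open>\<tau>\<close> into \<open>j\<close> becomes two steps of
    \<open>\<sigma>\<close>, passing through \<open>x\<close>.\<close>
  have sub: "y \<in> orbit \<sigma> i" if "y \<in> orbit \<tau> i" for y
    using that
  proof induction
    case base
    then show ?case
      by (cases "\<tau> i = j") (metis \<sigma>j \<sigma>x orbit.intros, metis \<sigma>other i orbit.base)
  next
    case (step y)
    have "y \<in> S"
      using step.hyps permutes_orbit_subset[OF \<tau> i] by auto
    then show ?case
      using step.IH
      by (cases "\<tau> y = j") (metis \<sigma>j \<sigma>x orbit.step, metis \<sigma>other orbit.step)
  qed
  \<comment> \<open>From \<open>S\<close>, \<open>\<sigma>\<close> enters \<open>x\<close> only at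
    the \<open>\<tau>\<close>-preimage of \<open>j\<close>; hence the condition attached to
    \<open>y = x\<close>.\<close>
  have sup: "(y = x \<and> j \<in> orbit \<tau> i) \<or> (y \<in> S \<and> y \<in> orbit \<tau> i)" if "y \<in> orbit \<sigma> i" for y
    using that
  proof induction
    case base
    then show ?case
      by (cases "\<tau> i = j") (metis \<sigma>j orbit.base, metis \<sigma>other \<tau>S i orbit.base)
  next
    case (step y)
    from step.IH show ?case
    proof
      assume "y = x \<and> j \<in> orbit \<tau> i"
      then show ?case using \<sigma>x j by auto
    next
      assume "y \<in> S \<and> y \<in> orbit \<tau> i"
      then show ?case
        by (cases "\<tau> y = j") (metis \<sigma>j orbit.step, metis \<sigma>other \<tau>S orbit.step)
    qed
  qed
  have "x \<in> orbit \<sigma> i" if "j \<in> orbit \<tau> i"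
    using that
  proof cases
    case base
    then show ?thesis
      by (metis \<sigma>j orbit.base)
  next
    case (step y)
    then show ?thesis
      by (metis \<sigma>j sub orbit.step)
  qed
  with sub sup show ?thesis
    unfolding \<sigma>_def[symmetric] by auto
qed

text \<open>As \<open>x\<close> is sent to \<open>j\<close>, it opens no orbit of its own but joins
  the cycle of \<open>j\<close>, whose product gains the factor \<open>a x\<close>, absorbed here
  into the entry at \<open>j\<close>.\<close>

lemma prod_cycle_eval_transpose_comp:
  assumes \<tau>: "\<tau> permutes S" and fin: "finite S" and x: "x \<notin> S" and j: "j \<in> S"
  shows "(\<Prod>C \<in> orbit (transpose x j \<circ> \<tau>) ` insert x S. cycle_eval f a C)
    = (\<Prod>C \<in> orbit \<tau> ` S. cycle_eval f (a(j := a j * a x)) C)"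
proof -
  define \<sigma> where "\<sigma> = transpose x j \<circ> \<tau>"
  define ins where "ins C = (if j \<in> C then insert x C else C)" for C
  have subS: "C \<subseteq> S" if "C \<in> orbit \<tau> ` S" for C
    using that permutes_orbit_subset[OF \<tau>] by auto
  have "permutation \<sigma>"
    unfolding \<sigma>_def using \<tau> fin
    by (intro permutation_compose permutation_swap_id) (rule permutes_imp_permutation)
  then have "orbit \<sigma> x = orbit \<sigma> (\<sigma> x)"
    by (simp add: permutation_orbit_step)
  moreover have "\<sigma> x = j"
    using \<tau> x by (simp add: \<sigma>_def permutes_not_in)
  ultimately have "orbit \<sigma> ` insert x S = orbit \<sigma> ` S"
    using j by auto
  also have "\<dots> = ins ` orbit \<tau> ` S"
    unfolding image_image \<sigma>_def ins_def
    by (intro image_cong refl orbit_transpose_comp[OF \<tau> x j])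
  finally have img: "orbit \<sigma> ` insert x S = ins ` orbit \<tau> ` S" .
  \<comment> \<open>Deleting \<open>x\<close> inverts \<open>ins\<close>, so no two orbits merge and
    the product over the set of orbits loses no factor.\<close>
  have "ins C - {x} = C" if "C \<in> orbit \<tau> ` S" for C
    using subS[OF that] x by (auto simp: ins_def)
  then have inj: "inj_on ins (orbit \<tau> ` S)"
    by (metis inj_onI)
  have "cycle_eval f a (ins C) = cycle_eval f (a(j := a j * a x)) C"
    if C: "C \<in> orbit \<tau> ` S" for C
  proof (cases "j \<in> C")
    case True
    have finC: "finite C" and xC: "x \<notin> C"
      using subS[OF C] fin x finite_subset by auto
    have "(\<Prod>r\<in>insert x C. a r) = a x * (a j * (\<Prod>r\<in>C - {j}. a r))"
      using finC xC True by (simp add: prod.remove)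
    also have "\<dots> = (\<Prod>r\<in>C. (a(j := a j * a x)) r)"
      using finC True by (simp add: prod.remove[of C j] mult_ac)
    finally show ?thesis
      using True by (simp add: cycle_eval_def ins_def)
  next
    case False
    then show ?thesis
      unfolding cycle_eval_def ins_def by (auto intro!: arg_cong[of _ _ f] prod.cong)
  qed
  then show ?thesis
    unfolding \<sigma>_def[symmetric] img prod.reindex[OF inj] by (auto intro: prod.cong)
qed

text \<open>Every permutation of \<open>insert x S\<close> is uniquely
  \<open>transpose x j \<circ> \<tau>\<close> with \<open>\<tau>\<close> permuting \<open>S\<close>.
  For \<open>j = x\<close> the point \<open>x\<close> stays fixed and yields \<open>f (a x)\<close>;
  for \<open>j \<in> S\<close> it enters the cycle of \<open>j\<close> and the sign flips.\<close>

lemma perm_sum_insert: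
  assumes fin: "finite S" and x: "x \<notin> S"
  shows "perm_sum (insert x S) f a
    = f (a x) * perm_sum S f a - (\<Sum>j\<in>S. perm_sum S f (a(j := a j * a x)))"
proof -
  define T where "T \<sigma> = of_int (sign \<sigma>) * (\<Prod>C \<in> orbit \<sigma> ` insert x S. cycle_eval f a C)" for \<sigma>
  have fixed: "T (transpose x x \<circ> \<tau>)
      = f (a x) * (of_int (sign \<tau>) * (\<Prod>C \<in> orbit \<tau> ` S. cycle_eval f a C))"
    if \<tau>: "\<tau> permutes S" for \<tau>
  proof -
    have "orbit \<tau> x = {x}"
      using \<tau> x by (simp add: orbit_eq_singleton_iff permutes_not_in)
    moreover have "{x} \<notin> orbit \<tau> ` S"
      using permutes_orbit_subset[OF \<tau>] x by fastforce
    ultimately show ?thesis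
      using fin by (simp add: T_def cycle_eval_def)
  qed
  have moved: "T (transpose x j \<circ> \<tau>)
      = - (of_int (sign \<tau>) * (\<Prod>C \<in> orbit \<tau> ` S. cycle_eval f (a(j := a j * a x)) C))"
    if \<tau>: "\<tau> permutes S" and j: "j \<in> S" for \<tau> j
  proof -
    have "sign (transpose x j \<circ> \<tau>) = - sign \<tau>"
      using permutes_imp_permutation[OF fin \<tau>] j x
      by (auto simp: sign_compose permutation_swap_id sign_swap_id)
    then show ?thesis
      unfolding T_def prod_cycle_eval_transpose_comp[OF \<tau> fin x j] by simp
  qed
  have "perm_sum (insert x S) f a = (\<Sum>j\<in>insert x S. \<Sum>\<tau> | \<tau> permutes S. T (transpose x j \<circ> \<tau>))"
    unfolding perm_sum_def T_def by (rule sum_over_permutations_insert[OF fin x])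
  also have "\<dots> = (\<Sum>\<tau> | \<tau> permutes S. T (transpose x x \<circ> \<tau>))
      + (\<Sum>j\<in>S. \<Sum>\<tau> | \<tau> permutes S. T (transpose x j \<circ> \<tau>))"
    using fin x by simp
  also have "(\<Sum>\<tau> | \<tau> permutes S. T (transpose x x \<circ> \<tau>)) = f (a x) * perm_sum S f a"
    unfolding perm_sum_def sum_distrib_left by (intro sum.cong refl fixed) simp
  also have "(\<Sum>j\<in>S. \<Sum>\<tau> | \<tau> permutes S. T (transpose x j \<circ> \<tau>))
      = (\<Sum>j\<in>S. - perm_sum S f (a(j := a j * a x)))"
    unfolding perm_sum_def sum_negf[symmetric] by (intro sum.cong refl moved) auto
  finally show ?thesis
    by (simp add: sum_negf)
qed

section \<open>Tuples with all arguments but one equal\<close>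

text \<open>This is \<open>Phi (Suc k) f\<close> at \<open>k\<close> copies of \<open>a\<close> and
  one \<open>b\<close>. In the clause for \<open>Suc k\<close>, the argument \<open>b\<close> either
  stands alone or is multiplied onto one of the \<open>Suc k\<close> copies of
  \<open>a\<close>.\<close>

fun polar_Phi :: "('a::comm_ring_1 \<Rightarrow> complex) \<Rightarrow> 'a \<Rightarrow> nat \<Rightarrow> 'a \<Rightarrow> complex" where
  "polar_Phi f a 0 b = f b"
| "polar_Phi f a (Suc k) b = f b * polar_Phi f a k a - of_nat (Suc k) * polar_Phi f a k (a * b)"

lemma perm_sum_polar:
  assumes "finite S" "card S = k" "x \<notin> S"
  shows "perm_sum (insert x S) f ((\<lambda>_. a)(x := b)) = polar_Phi f a k b"
  using assms
proof (induction k arbitrary: S x b)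
  case 0
  then show ?case
    by (simp add: perm_sum_insert)
next
  case (Suc k)
  \<comment> \<open>As \<open>x\<close> is arbitrary in the induction, any \<open>j\<close> in
    \<open>S\<close> can be the distinguished slot.\<close>
  have IH: "perm_sum S f ((\<lambda>_. a)(j := c)) = polar_Phi f a k c" if "j \<in> S" for j c
  proof -
    have "perm_sum (insert j (S - {j})) f ((\<lambda>_. a)(j := c)) = polar_Phi f a k c"
      using Suc.prems that by (intro Suc.IH) auto
    then show ?thesis
      by (simp only: insert_Diff[OF that])
  qed
  from Suc.prems obtain y where y: "y \<in> S"
    by fastforce
  \<comment> \<open>The entry \<open>b\<close> lies outside \<open>S\<close>, so the tuple is
    constant on \<open>S\<close>; one of its entries \<open>a\<close> is singled out as the last
    argument.\<close>
  have "perm_sum S f ((\<lambda>_. a)(x := b)) = perm_sum S f ((\<lambda>_. a)(y := a))"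
    using Suc.prems by (intro perm_sum_cong) auto
  also have "\<dots> = polar_Phi f a k a"
    by (rule IH[OF y])
  finally have const: "perm_sum S f ((\<lambda>_. a)(x := b)) = polar_Phi f a k a" .
  have "perm_sum S f (((\<lambda>_. a)(x := b))(j := ((\<lambda>_. a)(x := b)) j * b)) = polar_Phi f a k (a * b)"
    if "j \<in> S" for j
  proof -
    have "perm_sum S f (((\<lambda>_. a)(x := b))(j := ((\<lambda>_. a)(x := b)) j * b))
        = perm_sum S f ((\<lambda>_. a)(j := a * b))"
      using that Suc.prems by (intro perm_sum_cong) auto
    then show ?thesis
      using IH[OF that] by simp
  qed
  then have "(\<Sum>j\<in>S. perm_sum S f (((\<lambda>_. a)(x := b))(j := ((\<lambda>_. a)(x := b)) j * b)))
      = of_nat (Suc k) * polar_Phi f a k (a * b)"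
    using Suc.prems by simp
  then show ?case
    using perm_sum_insert[OF Suc.prems(1,3), of f "(\<lambda>_. a)(x := b)"] const
    by (simp only: fun_upd_same polar_Phi.simps)
qed

lemma Phi_polar: "Phi (Suc k) f ((\<lambda>_. a)(Suc k := b)) = polar_Phi f a k b"
proof -
  have "{1..Suc k} = insert (Suc k) {1..k}"
    by auto
  then show ?thesis
    unfolding Phi_eq_perm_sum by (simp add: perm_sum_polar)
qed

section \<open>Congruence modulo the radical\<close>

locale frobenius_functional = comm_complex_algebra smul
  for smul :: "complex \<Rightarrow> 'a::comm_ring_1 \<Rightarrow> 'a" +
  fixes n :: nat and f :: "'a \<Rightarrow> complex"
  assumes frobenius: "frobenius_hom smul n f"
begin

lemma linear_f: "Vector_Spaces.linear smul (*) f"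
  using frobenius by (simp add: frobenius_hom_def)

lemma f_1: "f 1 = of_nat n"
  using frobenius by (simp add: frobenius_hom_def)

sublocale f: Vector_Spaces.linear smul "(*)" f
  by (rule linear_f)

lemma polar_Phi_eq_0: "polar_Phi f a n b = 0"
  using frobenius by (simp add: frobenius_hom_def flip: Phi_polar)

lemma smul_mult_right: "a * smul c b = smul c (a * b)"
  using smul_mult_left[of c b a] by (simp add: mult.commute)

text \<open>The radical of the bilinear form \<open>f (a * b)\<close>: the largest ideal inside the
  kernel of \<open>f\<close>.\<close>

definition rad :: "'a set" where
  "rad = {a. \<forall>b. f (a * b) = 0}"

lemma rad_0 [simp]: "0 \<in> rad"
  by (simp add: rad_def f.zero)

lemma rad_add: "a \<in> rad \<Longrightarrow> b \<in> rad \<Longrightarrow> a + b \<in> rad"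
  by (simp add: rad_def distrib_right f.add)

lemma rad_uminus: "a \<in> rad \<Longrightarrow> - a \<in> rad"
  by (simp add: rad_def f.neg)

lemma rad_mult_right: "a \<in> rad \<Longrightarrow> a * b \<in> rad"
  by (simp add: rad_def mult.assoc)

lemma rad_mult_left: "a \<in> rad \<Longrightarrow> b * a \<in> rad"
  by (metis rad_mult_right mult.commute)

lemma rad_smul: "a \<in> rad \<Longrightarrow> smul c a \<in> rad"
  by (simp add: rad_def f.scale flip: smul_mult_left)

lemma rad_smul_cancel: "smul c a \<in> rad \<Longrightarrow> c \<noteq> 0 \<Longrightarrow> a \<in> rad"
  using rad_smul[of "smul c a" "inverse c"] by simp

lemma f_rad: "a \<in> rad \<Longrightarrow> f a = 0"
  by (metis (mono_tags, lifting) mem_Collect_eq mult.right_neutral rad_def)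

text \<open>Computing with this congruence replaces forming the quotient ring.\<close>

definition eqv :: "'a \<Rightarrow> 'a \<Rightarrow> bool" (infix "\<approx>" 50) where
  "a \<approx> b \<longleftrightarrow> a - b \<in> rad"

lemma eqv_refl [simp]: "a \<approx> a"
  by (simp add: eqv_def)

lemma eqv_sym: "a \<approx> b \<Longrightarrow> b \<approx> a"
  unfolding eqv_def using rad_uminus by fastforce

lemma eqv_trans [trans]: "a \<approx> b \<Longrightarrow> b \<approx> c \<Longrightarrow> a \<approx> c"
  unfolding eqv_def using rad_add by fastforce

lemma eqv_add: "a \<approx> b \<Longrightarrow> c \<approx> d \<Longrightarrow> a + c \<approx> b + d"
  unfolding eqv_def by (drule (1) rad_add) (simp add: algebra_simps)

lemma eqv_mult:
  assumes "a \<approx> b" "c \<approx> d"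
  shows "a * c \<approx> b * d"
proof -
  have "(a - b) * c + b * (c - d) \<in> rad"
    using assms unfolding eqv_def by (intro rad_add rad_mult_left rad_mult_right)
  then show ?thesis
    by (simp add: eqv_def algebra_simps)
qed

lemma eqv_smul: "a \<approx> b \<Longrightarrow> smul c a \<approx> smul c b"
  unfolding eqv_def by (drule rad_smul[of _ c]) (simp add: scale_right_diff_distrib)

lemma eqv_sum: "(\<And>i. i \<in> S \<Longrightarrow> a i \<approx> b i) \<Longrightarrow> sum a S \<approx> sum b S"
  by (induction S rule: infinite_finite_induct) (auto intro: eqv_add)

lemma eqv_prod: "(\<And>i. i \<in> S \<Longrightarrow> a i \<approx> b i) \<Longrightarrow> prod a S \<approx> prod b S"
  by (induction S rule: infinite_finite_induct) (auto intro: eqv_mult)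

lemma f_eqv: "a \<approx> b \<Longrightarrow> f a = f b"
  unfolding eqv_def by (drule f_rad) (simp add: f.diff)

lemma eqv_0: "a \<approx> 0 \<longleftrightarrow> a \<in> rad"
  by (simp add: eqv_def)

section \<open>Nilpotents and idempotents modulo the radical\<close>

text \<open>
  If \<open>c * c\<close> is in the radical, only the identity permutation contributes to \<open>\<Phi>\<^sub>n\<^sub>+\<^sub>1(c, \<dots>, c)\<close>.
\<close>

lemma rad_square:
  assumes "c * c \<in> rad"
  shows "c \<in> rad"
proof -
  have f0: "f d = 0" if d: "d * d \<in> rad" for d
  proof -
    have van: "polar_Phi f d k x = 0" if "x \<in> rad" for k x
      using that by (induction k arbitrary: x) (simp_all add: f_rad rad_mult_left)
    \<comment> \<open>The subtracted term has last argument \<open>d * d\<close> in the radical, so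
      each recursion step only multiplies by \<open>f d\<close>.\<close>
    have "polar_Phi f d k d = f d ^ Suc k" for k
      by (induction k) (simp_all add: van d)
    from this[of n] polar_Phi_eq_0[of d d] show ?thesis
      by (metis power_not_zero)
  qed
  have "c * b * (c * b) \<in> rad" for b
    using rad_mult_right[OF assms, of "b * b"] by (simp add: mult_ac)
  then have "f (c * b) = 0" for b
    by (rule f0)
  then show ?thesis
    by (simp add: rad_def)
qed

text \<open>For \<open>k \<ge> 1\<close> the square of \<open>c ^ k\<close> is a multiple of
  \<open>c ^ Suc k\<close>, so \<open>rad_square\<close> lowers the exponent by one.\<close>

lemma rad_power: "c ^ k \<in> rad \<Longrightarrow> c \<in> rad"
proof (induction k)
  case 0
  then show ?case
    using rad_mult_right[of 1 c] by simp
next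
  case (Suc k)
  show ?case
  proof (cases "k = 0")
    case True
    with Suc.prems show ?thesis by simp
  next
    case False
    have "c ^ k * c ^ k = c ^ Suc k * c ^ (k - 1)"
      using False by (cases k) (simp_all add: mult_ac)
    with Suc show ?thesis
      by (metis rad_mult_right rad_square)
  qed
qed

text \<open>If \<open>x \<approx> e\<close> then \<open>e * x \<approx> e\<close>, so on this class
  the recursion just multiplies by \<open>f e - of_nat (Suc k)\<close>. At \<open>k = n\<close> the
  product of all \<open>f e - of_nat i\<close> with \<open>i \<le> n\<close> is zero.\<close>

lemma f_idempotent:
  assumes "e * e \<approx> e"
  shows "\<exists>k\<le>n. f e = of_nat k"
proof -
  have "polar_Phi f e k x = (\<Prod>i\<le>k. f e - of_nat i)" if "x \<approx> e" for k x
    using that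
  proof (induction k arbitrary: x)
    case 0
    then show ?case by (simp add: f_eqv)
  next
    case (Suc k)
    have "e * x \<approx> e * e"
      using Suc.prems by (intro eqv_mult) auto
    then have "e * x \<approx> e"
      using assms by (rule eqv_trans)
    with Suc show ?case
      by (simp add: f_eqv algebra_simps)
  qed
  from this[of e n] show ?thesis
    by (auto simp: polar_Phi_eq_0)
qed

section \<open>Annihilating polynomials with simple roots\<close>

definition aeval :: "complex poly \<Rightarrow> 'a \<Rightarrow> 'a" where
  "aeval p a = poly (map_poly (\<lambda>c. smul c 1) p) a"

lemma aeval_0 [simp]: "aeval 0 a = 0"
  by (simp add: aeval_def)

lemma aeval_pCons [simp]: "aeval (pCons c p) a = smul c 1 + a * aeval p a"
  by (simp add: aeval_def map_poly_pCons)

lemma aeval_add: "aeval (p + q) a = aeval p a + aeval q a"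
  by (induction p q rule: poly_induct2) (simp_all add: scale_left_distrib algebra_simps)

lemma aeval_smult: "aeval (smult c p) a = smul c (aeval p a)"
  by (induction p) (simp_all add: scale_right_distrib smul_mult_right)

text \<open>
  For \<open>k = n\<close> the left-hand side vanishes, and this becomes an analogue of the Cayley--Hamilton theorem.
\<close>

lemma polar_Phi_aeval: "\<exists>p. coeff p k \<noteq> 0 \<and> (\<forall>b. polar_Phi f a k b = f (aeval p a * b))"
proof (induction k)
  case 0
  show ?case
    by (rule exI[of _ "[:1:]"]) simp
next
  case (Suc k)
  then obtain p where p: "coeff p k \<noteq> 0" "\<And>b. polar_Phi f a k b = f (aeval p a * b)"
    by blast
  \<comment> \<open>The recursion for \<open>polar_Phi\<close>, with multiplication by
    \<open>a\<close> as the shift \<open>pCons\<close>. The coefficient at \<open>Suc k\<close> is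
    \<open>- of_nat (Suc k)\<close> times that of \<open>p\<close> at \<open>k\<close>, hence
    nonzero.\<close>
  let ?q = "pCons (polar_Phi f a k a) (smult (- of_nat (Suc k)) p)"
  have "polar_Phi f a (Suc k) b = f (aeval ?q a * b)" for b
  proof -
    have "aeval ?q a * b
        = smul (polar_Phi f a k a) 1 * b + a * smul (- of_nat (Suc k)) (aeval p a) * b"
      by (simp only: aeval_pCons aeval_smult distrib_right)
    also have "\<dots> = smul (polar_Phi f a k a) b + smul (- of_nat (Suc k)) (aeval p a * (a * b))"
      by (simp only: smul_mult_right mult_1_left mult_ac flip: smul_mult_left)
    finally have "aeval ?q a * b
        = smul (polar_Phi f a k a) b + smul (- of_nat (Suc k)) (aeval p a * (a * b))" .
    then show ?thesis
      by (simp only: f.add f.scale p(2) polar_Phi.simps) (simp add: algebra_simps)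
  qed
  moreover have "coeff ?q (Suc k) \<noteq> 0"
    using p(1) by (simp del: of_nat_Suc)
  ultimately show ?case
    by blast
qed

text \<open>Linear factors of \<open>p\<close> are split off root by root and moved into
  \<open>b\<close>, which therefore varies in the induction; the nonzero constant left at the end
  cancels.\<close>

lemma aeval_factor:
  assumes "p \<noteq> 0" "aeval p a * b \<in> rad"
  shows "\<exists>rs. (\<Prod>r\<leftarrow>rs. a - smul r 1) * b \<in> rad"
  using assms
proof (induction "degree p" arbitrary: p b)
  case 0
  then obtain c where "p = [:c:]" "c \<noteq> 0"
    by (metis degree_eq_zeroE pCons_eq_0_iff)
  with 0 have "smul c b \<in> rad"
    by (simp flip: smul_mult_left)
  then have "b \<in> rad"
    using \<open>c \<noteq> 0\<close> by (rule rad_smul_cancel)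
  then show ?case
    by (intro exI[of _ "[]"]) simp
next
  case (Suc d)
  then have "\<not> constant (poly p)"
    by (simp add: constant_degree)
  then obtain r where "poly p r = 0"
    using fundamental_theorem_of_algebra by blast
  then obtain q where q: "p = [:-r, 1:] * q"
    by (auto simp: poly_eq_0_iff_dvd elim: dvdE)
  with Suc.prems have "q \<noteq> 0"
    by auto
  with q Suc.hyps(2) have deg: "d = degree q"
    by (simp add: degree_mult_eq del: mult_pCons_left)
  have "p = smult (- r) q + pCons 0 q"
    by (simp add: q)
  then have "aeval p a = (a - smul r 1) * aeval q a"
    by (simp only: aeval_add aeval_smult aeval_pCons) (simp add: left_diff_distrib flip: smul_mult_left)
  with Suc.prems have "aeval q a * ((a - smul r 1) * b) \<in> rad"
    by (simp add: mult_ac)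
  from Suc.hyps(1)[OF deg \<open>q \<noteq> 0\<close> this]
  obtain rs where "(\<Prod>r\<leftarrow>rs. a - smul r 1) * ((a - smul r 1) * b) \<in> rad"
    by blast
  then show ?case
    by (intro exI[of _ "r # rs"]) (simp add: mult_ac)
qed

text \<open>The linear factors from \<open>aeval_factor\<close> may repeat, but their product
  divides a power of the product over the distinct roots; \<open>rad_power\<close> removes the
  exponent.\<close>

lemma squarefree_annihilator: "\<exists>S. finite S \<and> (\<Prod>r\<in>S. a - smul r 1) \<in> rad"
proof -
  obtain p where p: "coeff p n \<noteq> 0" "\<And>b. polar_Phi f a n b = f (aeval p a * b)"
    using polar_Phi_aeval[of n a] by blast
  have "p \<noteq> 0"
    using p(1) by auto
  moreover have "aeval p a * 1 \<in> rad"
    using p(2) polar_Phi_eq_0 by (simp add: rad_def)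
  ultimately obtain rs where "(\<Prod>r\<leftarrow>rs. a - smul r 1) * 1 \<in> rad"
    using aeval_factor by blast
  then have rs: "(\<Prod>r\<leftarrow>rs. a - smul r 1) \<in> rad"
    by simp
  have "(\<Prod>r\<leftarrow>xs. a - smul r 1) dvd (\<Prod>r\<in>set rs. a - smul r 1) ^ length xs"
    if "set xs \<subseteq> set rs" for xs
    using that by (induction xs) (auto intro!: mult_dvd_mono dvd_prodI)
  from this[of rs] have "(\<Prod>r\<in>set rs. a - smul r 1) ^ length rs \<in> rad"
    using rs by (auto elim!: dvdE simp: rad_mult_right)
  then show ?thesis
    using rad_power by blast
qed

section \<open>Eigenvectors and joint idempotents\<close>

text \<open>By induction \<open>b * (a - smul s 1)\<close> decomposes over the other roots. As
  \<open>a - smul s 1\<close> acts as \<open>r - s\<close> on the component at \<open>r\<close>,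
  dividing by \<open>r - s\<close> recovers that component of \<open>b\<close>; the remainder is
  killed by \<open>a - smul s 1\<close> and belongs to \<open>s\<close>.\<close>

lemma eigen_decomposition:
  assumes "finite S" "b * (\<Prod>r\<in>S. a - smul r 1) \<in> rad"
  shows "\<exists>e. b \<approx> (\<Sum>r\<in>S. e r) \<and> (\<forall>r\<in>S. a * e r \<approx> smul r (e r))"
  using assms
proof (induction S arbitrary: b rule: finite_induct)
  case empty
  then show ?case by (simp add: eqv_0)
next
  case (insert s S)
  then have "b * (a - smul s 1) * (\<Prod>r\<in>S. a - smul r 1) \<in> rad"
    by (simp add: mult_ac)
  then obtain c where c: "b * (a - smul s 1) \<approx> (\<Sum>r\<in>S. c r)"
      "\<And>r. r \<in> S \<Longrightarrow> a * c r \<approx> smul r (c r)"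
    using insert.IH by blast
  define e where "e r = (if r = s then b - (\<Sum>r\<in>S. smul (inverse (r - s)) (c r))
    else smul (inverse (r - s)) (c r))" for r
  have "(\<Sum>r\<in>S. e r) = (\<Sum>r\<in>S. smul (inverse (r - s)) (c r))"
    using insert.hyps by (intro sum.cong) (auto simp: e_def)
  then have sum_e: "(\<Sum>r\<in>insert s S. e r) = b" and es: "e s = b - (\<Sum>r\<in>S. e r)"
    using insert.hyps by (simp_all add: e_def)
  have eig: "a * e r \<approx> smul r (e r)" if "r \<in> S" for r
  proof -
    have "a * smul (inverse (r - s)) (c r) \<approx> smul (inverse (r - s)) (smul r (c r))"
      unfolding smul_mult_right by (intro eqv_smul c that)
    then show ?thesis
      using that insert.hyps by (auto simp: e_def mult.commute)
  qed
  have "(a - smul s 1) * e r \<approx> c r" if "r \<in> S" for r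
  proof -
    have "a * e r - smul s (e r) \<approx> smul r (e r) - smul s (e r)"
      using eig[OF that] by (simp add: eqv_def)
    also have "smul r (e r) - smul s (e r) = c r"
      using that insert.hyps by (auto simp: e_def simp flip: scale_left_diff_distrib)
    finally show ?thesis
      by (simp add: left_diff_distrib flip: smul_mult_left)
  qed
  then have "(\<Sum>r\<in>S. (a - smul s 1) * e r) \<approx> (\<Sum>r\<in>S. c r)"
    by (rule eqv_sum)
  then have "b * (a - smul s 1) \<approx> (\<Sum>r\<in>S. (a - smul s 1) * e r)"
    using c(1) by (blast intro: eqv_trans eqv_sym)
  then have "b * (a - smul s 1) - (a - smul s 1) * (\<Sum>r\<in>S. e r) \<in> rad"
    by (simp only: eqv_def sum_distrib_left)
  then have "(a - smul s 1) * e s \<in> rad"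
    by (simp only: es right_diff_distrib mult.commute)
  then have "a * e s \<approx> smul s (e s)"
    by (simp add: eqv_def left_diff_distrib flip: smul_mult_left)
  with eig sum_e show ?case
    by (intro exI[of _ e]) auto
qed

text \<open>Multiplying the decompositions of \<open>1\<close> for all \<open>u i\<close> and
  expanding gives one summand per choice \<open>g\<close> of eigenvalues; its factor
  \<open>E i (g i)\<close> makes it an eigenvector of \<open>u i\<close>.\<close>

lemma joint_decomposition:
  fixes u :: "'m::finite \<Rightarrow> 'a"
  shows "\<exists>G e. finite G \<and> 1 \<approx> (\<Sum>g\<in>G. e g) \<and> (\<forall>g\<in>G. \<forall>i. u i * e g \<approx> smul (g i) (e g))"
proof -
  have "\<exists>S. \<forall>i. finite (S i) \<and> (\<Prod>r\<in>S i. u i - smul r 1) \<in> rad"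
    by (intro choice allI squarefree_annihilator)
  then obtain S where S: "\<And>i. finite (S i)" "\<And>i. (\<Prod>r\<in>S i. u i - smul r 1) \<in> rad"
    by blast
  have "\<exists>E. \<forall>i. 1 \<approx> (\<Sum>r\<in>S i. E i r) \<and> (\<forall>r\<in>S i. u i * E i r \<approx> smul r (E i r))"
    using S by (intro choice allI eigen_decomposition) simp_all
  then obtain E where E: "\<And>i. 1 \<approx> (\<Sum>r\<in>S i. E i r)"
      "\<And>i r. r \<in> S i \<Longrightarrow> u i * E i r \<approx> smul r (E i r)"
    by blast
  define e where "e g = (\<Prod>i\<in>UNIV. E i (g i))" for g :: "'m \<Rightarrow> complex"
  have "(\<Prod>i\<in>(UNIV::'m set). 1) \<approx> (\<Prod>i\<in>UNIV. \<Sum>r\<in>S i. E i r)"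
    by (intro eqv_prod E)
  also have "\<dots> = (\<Sum>g\<in>PiE UNIV S. e g)"
    unfolding e_def using S(1) by (intro prod_sum_PiE) auto
  finally have "1 \<approx> (\<Sum>g\<in>PiE UNIV S. e g)"
    by simp
  moreover have "u i * e g \<approx> smul (g i) (e g)" if "g \<in> PiE UNIV S" for g i
  proof -
    have e: "e g = E i (g i) * (\<Prod>i\<in>UNIV - {i}. E i (g i))"
      unfolding e_def by (rule prod.remove) auto
    have "u i * E i (g i) * (\<Prod>i\<in>UNIV - {i}. E i (g i))
        \<approx> smul (g i) (E i (g i)) * (\<Prod>i\<in>UNIV - {i}. E i (g i))"
      using that by (intro eqv_mult E eqv_refl) (auto simp: PiE_def)
    then show ?thesis
      by (simp add: e mult.assoc flip: smul_mult_left)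
  qed
  moreover have "finite (PiE UNIV S)"
    using S(1) by (intro finite_PiE) auto
  ultimately show ?thesis
    by blast
qed

text \<open>Distinct \<open>g\<close> and \<open>h\<close> differ at some \<open>i\<close>, where
  \<open>e g * e h\<close> has both eigenvalues and so vanishes modulo the radical. Orthogonality
  makes each \<open>e g\<close> idempotent, and \<open>f_idempotent\<close> supplies the
  weights.\<close>

lemma joint_idempotents:
  fixes u :: "'m::finite \<Rightarrow> 'a"
  shows "\<exists>G e w. finite G \<and> 1 \<approx> (\<Sum>g\<in>G. e g) \<and> (\<forall>g\<in>G. \<forall>i. u i * e g \<approx> smul (g i) (e g))
    \<and> (\<forall>g\<in>G. f (e g) = of_nat (w g)) \<and> n = (\<Sum>g\<in>G. w g)"
proof -
  obtain G e where G: "finite G" "1 \<approx> (\<Sum>g\<in>G. e g)"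
      "\<And>g i. g \<in> G \<Longrightarrow> u i * e g \<approx> smul (g i) (e g)"
    using joint_decomposition[of u] by blast
  have orth: "e g * e h \<approx> 0" if gh: "g \<in> G" "h \<in> G" "g \<noteq> h" for g h
  proof -
    obtain i where i: "g i \<noteq> h i"
      using gh by blast
    have "u i * e g * e h \<approx> smul (g i) (e g) * e h"
      using gh by (intro eqv_mult G eqv_refl)
    moreover have "e g * (u i * e h) \<approx> e g * smul (h i) (e h)"
      using gh by (intro eqv_mult G eqv_refl)
    ultimately have "smul (g i) (e g * e h) \<approx> smul (h i) (e g * e h)"
      by (metis eqv_sym eqv_trans mult.assoc mult.left_commute smul_mult_left smul_mult_right)
    then have "smul (g i - h i) (e g * e h) \<in> rad"
      unfolding eqv_def by (simp add: scale_left_diff_distrib)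
    then show ?thesis
      using i rad_smul_cancel by (simp add: eqv_0)
  qed
  have "\<exists>k. f (e g) = of_nat k" if g: "g \<in> G" for g
  proof -
    have "e g * 1 \<approx> e g * (\<Sum>h\<in>G. e h)"
      by (intro eqv_mult G eqv_refl)
    also have "\<dots> = (\<Sum>h\<in>G. e g * e h)"
      by (rule sum_distrib_left)
    also have "\<dots> \<approx> (\<Sum>h\<in>G. if h = g then e g * e g else 0)"
      using g orth by (intro eqv_sum) auto
    also have "\<dots> = e g * e g"
      using G(1) g by simp
    finally have "e g * e g \<approx> e g"
      by (simp add: eqv_sym)
    then show ?thesis
      using f_idempotent by blast
  qed
  then obtain w where w: "\<And>g. g \<in> G \<Longrightarrow> f (e g) = of_nat (w g)"
    by metis
  \<comment> \<open>The weights add up to \<open>f 1\<close>, and \<open>of_nat\<close> is injective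
    into the complex numbers.\<close>
  have "of_nat n = f (\<Sum>g\<in>G. e g)"
    using f_eqv[OF G(2)] f_1 by simp
  also have "\<dots> = of_nat (\<Sum>g\<in>G. w g)"
    by (simp add: f.sum w)
  finally have "n = (\<Sum>g\<in>G. w g)"
    using of_nat_eq_iff by blast
  with G w show ?thesis
    by blast
qed

end

section \<open>Points with multiplicity and evaluation of polynomials\<close>

text \<open>A list repeats each \<open>g\<close> exactly \<open>w g\<close> times. It is chosen
  before \<open>F\<close>, so the same points will serve all polynomials.\<close>

lemma of_nat_weights_as_points:
  assumes "finite G"
  shows "\<exists>x :: nat \<Rightarrow> 'b. \<forall>F :: 'b \<Rightarrow> complex.
    (\<Sum>i = 1..(\<Sum>g\<in>G. w g). F (x i)) = (\<Sum>g\<in>G. of_nat (w g) * F g)"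
proof -
  obtain xs where xs: "mset xs = (\<Sum>g\<in>G. replicate_mset (w g) g)"
    using ex_mset by blast
  have len: "length xs = (\<Sum>g\<in>G. w g)"
    by (metis (no_types, lifting) size_mset size_multiset_sum size_replicate_mset sum.cong xs)
  have "(\<Sum>i = 1..(\<Sum>g\<in>G. w g). F (xs ! (i - 1))) = (\<Sum>g\<in>G. of_nat (w g) * F g)"
    for F :: "'b \<Rightarrow> complex"
  proof -
    have "(\<Sum>i = 1..length xs. F (xs ! (i - 1))) = (\<Sum>i<length xs. F (xs ! i))"
      by (rule sum.reindex_bij_witness[of _ Suc "\<lambda>i. i - 1"]) auto
    also have "\<dots> = (\<Sum>y\<leftarrow>xs. F y)"
      by (simp add: sum_list_sum_nth atLeast0LessThan)
    also have "\<dots> = (\<Sum>y\<in>#mset xs. F y)"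
      by (metis mset_map sum_mset_sum_list)
    also have "\<dots> = (\<Sum>g\<in>G. of_nat (w g) * F g)"
      unfolding xs using assms by (induction G rule: finite_induct) auto
    finally show ?thesis
      by (simp add: len)
  qed
  then show ?thesis
    \<comment> \<open>Points are numbered from 1, list entries from 0.\<close>
    by (intro exI[of _ "\<lambda>i. xs ! (i - 1)"] allI)
qed

text \<open>This form reduces the action of \<open>p\<close> on a joint eigenvector to the action of
  the variables.\<close>

lemma cpoly_eq_sum_monomials:
  fixes p :: "'m::finite cpoly"
  shows "p = (\<Sum>e\<in>Poly_Mapping.keys p. cpoly_smul (Poly_Mapping.lookup p e)
    (\<Prod>i\<in>UNIV. Poly_Mapping.single (Poly_Mapping.single i 1) 1 ^ Poly_Mapping.lookup e i))"
proof -
  have pow: "Poly_Mapping.single (Poly_Mapping.single i 1) 1 ^ k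
      = Poly_Mapping.single (Poly_Mapping.single i k) (1::complex)" for i :: 'm and k :: nat
    by (induction k) (simp_all add: mult_single flip: single_add)
  have prod: "(\<Prod>i\<in>A. Poly_Mapping.single (h i) 1) = Poly_Mapping.single (\<Sum>i\<in>A. h i) (1::complex)"
    for A and h :: "'m \<Rightarrow> 'm \<Rightarrow>\<^sub>0 nat"
    by (induction A rule: infinite_finite_induct) (simp_all add: mult_single)
  have e: "(\<Sum>i\<in>UNIV. Poly_Mapping.single i (Poly_Mapping.lookup e i)) = e"
    for e :: "'m \<Rightarrow>\<^sub>0 nat"
    by (rule poly_mapping_eqI) (simp add: lookup_sum lookup_single when_def)
  have "p = (\<Sum>e\<in>Poly_Mapping.keys p. Poly_Mapping.single e (Poly_Mapping.lookup p e))"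
    by (rule poly_mapping_eqI) (auto simp: lookup_sum lookup_single when_def in_keys_iff)
  moreover have "cpoly_smul c
      (\<Prod>i\<in>UNIV. Poly_Mapping.single (Poly_Mapping.single i 1) 1 ^ Poly_Mapping.lookup e i)
    = Poly_Mapping.single e c" for c and e :: "'m \<Rightarrow>\<^sub>0 nat"
    unfolding cpoly_smul_def pow prod e mult_single by simp
  ultimately show ?thesis
    by simp
qed

theorem theorem3p2:
  fixes f :: "'m::finite cpoly \<Rightarrow> complex" and n :: nat
  assumes "frobenius_hom cpoly_smul n f"
  shows "\<exists>x :: nat \<Rightarrow> complex ^ 'm. \<forall>p. f p = (\<Sum>i = 1..n. cpoly_eval p (x i))"
proof -
  interpret frobenius_functional cpoly_smul n f
    using assms comm_complex_algebra_cpoly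
    by (simp add: frobenius_functional_def frobenius_functional_axioms_def)
  define u :: "'m \<Rightarrow> 'm cpoly" where "u i = Poly_Mapping.single (Poly_Mapping.single i 1) 1" for i
  obtain G e w where G: "finite G" "1 \<approx> (\<Sum>g\<in>G. e g)"
      "\<And>g i. g \<in> G \<Longrightarrow> u i * e g \<approx> cpoly_smul (g i) (e g)"
      "\<And>g. g \<in> G \<Longrightarrow> f (e g) = of_nat (w g)" "n = (\<Sum>g\<in>G. w g)"
    using joint_idempotents[of u] by blast
  \<comment> \<open>The eigenvector relation passes from the variables to powers, then to monomials,
    then to linear combinations, where the scalars add up to the value of \<open>p\<close> at
    \<open>g\<close>.\<close>
  have acts: "p * e g \<approx> cpoly_smul (cpoly_eval p (vec_lambda g)) (e g)" if g: "g \<in> G" for p g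
  proof -
    have pow: "u i ^ k * e g \<approx> cpoly_smul (g i ^ k) (e g)" for i k
    proof (induction k)
      case (Suc k)
      have "u i * (u i ^ k * e g) \<approx> u i * cpoly_smul (g i ^ k) (e g)"
        by (intro eqv_mult Suc eqv_refl)
      also have "\<dots> = cpoly_smul (g i ^ k) (u i * e g)"
        by (rule smul_mult_right)
      also have "\<dots> \<approx> cpoly_smul (g i ^ k) (cpoly_smul (g i) (e g))"
        by (intro eqv_smul G g)
      finally show ?case
        by (simp add: mult_ac)
    qed simp
    have mon: "(\<Prod>i\<in>A. u i ^ k i) * e g \<approx> cpoly_smul (\<Prod>i\<in>A. g i ^ k i) (e g)" if "finite A" for A k
      using that
    proof induction
      case (insert j A)
      have "u j ^ k j * ((\<Prod>i\<in>A. u i ^ k i) * e g) \<approx> u j ^ k j * cpoly_smul (\<Prod>i\<in>A. g i ^ k i) (e g)"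
        by (intro eqv_mult insert.IH eqv_refl)
      also have "\<dots> = cpoly_smul (\<Prod>i\<in>A. g i ^ k i) (u j ^ k j * e g)"
        by (rule smul_mult_right)
      also have "\<dots> \<approx> cpoly_smul (\<Prod>i\<in>A. g i ^ k i) (cpoly_smul (g j ^ k j) (e g))"
        by (intro eqv_smul pow)
      finally show ?case
        using insert.hyps by (simp add: mult_ac)
    qed simp
    have "p * e g = (\<Sum>d\<in>Poly_Mapping.keys p. cpoly_smul (Poly_Mapping.lookup p d)
        ((\<Prod>i\<in>UNIV. u i ^ Poly_Mapping.lookup d i) * e g))"
      unfolding u_def
      by (subst cpoly_eq_sum_monomials[of p]) (simp only: sum_distrib_right smul_mult_left)
    also have "\<dots> \<approx> (\<Sum>d\<in>Poly_Mapping.keys p. cpoly_smul (Poly_Mapping.lookup p d)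
        (cpoly_smul (\<Prod>i\<in>UNIV. g i ^ Poly_Mapping.lookup d i) (e g)))"
      by (intro eqv_sum eqv_smul mon) simp
    also have "\<dots> = cpoly_smul (cpoly_eval p (vec_lambda g)) (e g)"
      by (simp add: cpoly_eval_def scale_sum_left)
    finally show ?thesis .
  qed
  have "f p = (\<Sum>g\<in>G. of_nat (w g) * cpoly_eval p (vec_lambda g))" for p
  proof -
    \<comment> \<open>Applying \<open>f\<close> to this decomposition of \<open>p\<close> turns each
      summand into the weight of \<open>g\<close> times the value of \<open>p\<close> at
      \<open>g\<close>.\<close>
    have "p * 1 \<approx> p * (\<Sum>g\<in>G. e g)"
      by (intro eqv_mult G eqv_refl)
    also have "\<dots> = (\<Sum>g\<in>G. p * e g)"
      by (rule sum_distrib_left)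
    also have "\<dots> \<approx> (\<Sum>g\<in>G. cpoly_smul (cpoly_eval p (vec_lambda g)) (e g))"
      by (intro eqv_sum acts)
    finally show ?thesis
      by (auto dest!: f_eqv simp: f.sum f.scale G(4) mult.commute)
  qed
  moreover obtain x where x: "\<And>F :: ('m \<Rightarrow> complex) \<Rightarrow> complex.
      (\<Sum>i = 1..n. F (x i)) = (\<Sum>g\<in>G. of_nat (w g) * F g)"
    using of_nat_weights_as_points[OF G(1), of w] G(5) by blast
  ultimately have "f p = (\<Sum>i = 1..n. cpoly_eval p (vec_lambda (x i)))" for p
    using x[of "\<lambda>g. cpoly_eval p (vec_lambda g)"] by (simp only:)
  then show ?thesis
    by (intro exI[of _ "\<lambda>i. vec_lambda (x i)"] allI)
qed

end
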